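(* Let $p=2$, and let $d=\deg(P)$. Then: (a) if $a\not\equiv 0\pmod P$ and $\mathrm{Tr}(b/a^2)\equiv 0\pmod P$, then $\alpha(P)\mid q^d-1$ and $\pi(P)\mid q^d-1$; (b) if $a\not\equiv 0\pmod P$ and $\mathrm{Tr}(b/a^2)\not\equiv 0\pmod P$, then $\alpha(P)\mid q^d+1$ and $\pi(P)\mid (q^d+1)\,\mathrm{ord}_P(b)$; (c) if $a\equiv 0\pmod P$, then $\alpha(P)=2$ and $\pi(P)=2\,\mathrm{ord}_P(b)$.
   Context: Let $\mathbb{F}_q$ be the finite field with $q=p^l$ elements, $p$ prime, $l\ge1$. Fix $a,b\in\mathbb{F}_q[x]$ with $b\neq 0$. The generalized Fibonacci sequence is $F_0=0$, $F_1=1$, $F_n=aF_{n-1}+bF_{n-2}$ for $n\ge 2$. Let $P\in\mathbb{F}_q[x]$ be an irreducible polynomial with $\gcd(b,P)=1$. The rank $\alpha(P)$ is the least positive integer $n$ with $F_n\equiv 0\pmod P$, and the period $\pi(P)$ is the least positive integer $n$ with $F_n\equiv 0$ and $F_{n+1}\equiv 1\pmod P$. For $g$ coprime to $P$, $\mathrm{ord}_P(g)$ is the multiplicative order of $g$ modulo $P$. For $p=2$, identifying $\mathbb{F}_q[x]/P\mathbb{F}_q[x]$ with $\mathbb{F}_{q^d}$, the trace is $\mathrm{Tr}(y)=\sum_{i=0}^{dl-1}y^{2^i}$ for $y\in\mathbb{F}_{q^d}$ (so $q^d=2^{dl}$), and $\mathrm{Tr}(b/a^2)$ is the trace of the residue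 class of $b/a^2$ modulo $P$. *)

theory Defs
  imports
    "HOL-Computational_Algebra.Polynomial"
    "HOL-Number_Theory.Cong"
    "HOL-Library.Cardinality"
begin

fun gen_fib :: "'a::comm_ring_1 \<Rightarrow> 'a \<Rightarrow> nat \<Rightarrow> 'a" where
  "gen_fib a b 0 = 0"
| "gen_fib a b (Suc 0) = 1"
| "gen_fib a b (Suc (Suc n)) = a * gen_fib a b (Suc n) + b * gen_fib a b n"

definition fib_rank :: "'a::field poly \<Rightarrow> 'a poly \<Rightarrow> 'a poly \<Rightarrow> nat" where
  "fib_rank a b P = (LEAST n. n > 0 \<and> [gen_fib a b n = 0] (mod P))"

definition fib_period :: "'a::field poly \<Rightarrow> 'a poly \<Rightarrow> 'a poly \<Rightarrow> nat" where
  "fib_period a b P =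
     (LEAST n. n > 0 \<and> [gen_fib a b n = 0] (mod P) \<and> [gen_fib a b (n + 1) = 1] (mod P))"

definition poly_ord :: "'a::field poly \<Rightarrow> 'a poly \<Rightarrow> nat" where
  "poly_ord P g = (LEAST n. n > 0 \<and> [g ^ n = 1] (mod P))"

text \<open>The residue class of \<open>g / h\<close> modulo \<open>P\<close>, given by its reduced representative;
  meaningful only for \<open>h\<close> coprime to \<open>P\<close>.\<close>

definition quot_mod :: "'a::field poly \<Rightarrow> 'a poly \<Rightarrow> 'a poly \<Rightarrow> 'a poly" where
  "quot_mod P g h = (THE r. r mod P = r \<and> [r * h = g] (mod P))"

text \<open>The absolute trace of the field with \<open>2 ^ (degree P * l)\<close> elements, viewed as the
  residue field modulo \<open>P\<close> of the polynomial ring over the field with \<open>2 ^ l\<close> elements.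
  Residue classes are given by representatives; the value is the reduced one.\<close>

definition trace_mod :: "nat \<Rightarrow> 'a::field poly \<Rightarrow> 'a poly \<Rightarrow> 'a poly" where
  "trace_mod l P y = (\<Sum>i<degree P * l. y ^ (2 ^ i)) mod P"

end

theory Submission
  imports Defs
    "HOL-Computational_Algebra.Polynomial_Factorial"
begin

text \<open>
  The sequence is governed by a root \<open>t\<close> of \<open>X\<^sup>2 - a X - b\<close>: for \<open>n > 0\<close> one has
  \<open>t ^ n = F\<^sub>n t + b F\<^bsub>n-1\<^esub>\<close>.  In characteristic two, squaring is additive, so the powers
  \<open>t ^ 2 ^ i\<close> can be computed in closed form.  With \<open>c = b / a\<^sup>2\<close> and
  \<open>T\<^sub>i = c + c ^ 2 + \<dots> + c ^ 2 ^ (i - 1)\<close> the result is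
  \<open>t ^ 2 ^ i = a ^ (2 ^ i - 1) t + a ^ 2 ^ i T\<^sub>i\<close>.  In terms of the sequence alone, this is the
  pair of lemmas \<open>gen_fib_pow2_char_2\<close> and \<open>gen_fib_pow2_minus_1_char_2\<close>, which follow from the
  doubling formulas.

  Let \<open>N = q ^ d = 2 ^ (d l)\<close> be the size of the residue field and suppose that \<open>P\<close> does not divide
  \<open>a\<close>.  Fermat's theorem modulo \<open>P\<close> (\<open>poly_fermat\<close>) turns the closed form at \<open>i = d l\<close> into
  \<open>F\<^sub>N \<equiv> 1\<close> and \<open>b F\<^bsub>N-1\<^esub> \<equiv> a T\<close>, where \<open>T\<close> is the trace of \<open>c\<close>
  (\<open>gen_fib_at_field_size\<close>).  The trace is fixed by squaring and hence \<open>0\<close> or \<open>1\<close>.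

  If \<open>T \<equiv> 0\<close>, then \<open>F\<^bsub>N-1\<^esub> \<equiv> 0\<close> and \<open>F\<^sub>N \<equiv> 1\<close>, so the sequence has returned to its
  starting values after \<open>N - 1\<close> steps.  If \<open>T \<equiv> 1\<close>, then \<open>F\<^bsub>N+1\<^esub> = a F\<^sub>N + b F\<^bsub>N-1\<^esub> \<equiv> 2 a = 0\<close>
  and \<open>F\<^bsub>N+2\<^esub> \<equiv> b\<close>: after \<open>N + 1\<close> steps the sequence starts again, multiplied by \<open>b\<close>, and
  \<open>ord\<^sub>P b\<close> such rounds give the factor \<open>1\<close>.  The divisibility claims follow because the zeros of
  the sequence modulo \<open>P\<close>, and likewise the places where it starts again, are closed under
  differences (\<open>fib_rank_dvd\<close>, \<open>fib_period_dvd\<close>).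

  If \<open>a \<equiv> 0\<close>, the sequence is \<open>0, 1, 0, b, 0, b\<^sup>2, \<dots>\<close> modulo \<open>P\<close>, and both values can be read
  off.
\<close>

section \<open>Identities for the generalized Fibonacci sequence\<close>

lemma gen_fib_add:
  "gen_fib a b (m + k + 1) = gen_fib a b (m + 1) * gen_fib a b (k + 1)
     + b * gen_fib a b m * gen_fib a b k"
proof (induction a b k rule: gen_fib.induct)
  case (3 a b k)
  have "gen_fib a b (m + Suc (Suc k) + 1)
      = a * gen_fib a b (m + Suc k + 1) + b * gen_fib a b (m + k + 1)"
    by simp
  then show ?case
    unfolding "3.IH" by (simp add: algebra_simps)
qed (auto simp: algebra_simps)

lemma gen_fib_cong:
  fixes a b c P :: "'a::field poly"
  assumes "[b = c] (mod P)"
  shows "[gen_fib a b n = gen_fib a c n] (mod P)"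
  using assms
  by (induction a b n rule: gen_fib.induct) (auto intro!: cong_add cong_mult)

lemma char_2_square_add:
  fixes x y :: "'a::comm_ring_1"
  assumes "(2::'a) = 0"
  shows "(x + y)\<^sup>2 = x\<^sup>2 + y\<^sup>2"
  using assms by (simp add: power2_sum)

lemma char_2_square_sum:
  fixes f :: "nat \<Rightarrow> 'a::comm_ring_1"
  assumes "(2::'a) = 0"
  shows "(\<Sum>i<n. f i)\<^sup>2 = (\<Sum>i<n. (f i)\<^sup>2)"
  by (induction n) (simp_all add: char_2_square_add[OF assms])

text \<open>In general \<open>F\<^bsub>2n\<^esub> = F\<^sub>n (a F\<^sub>n + 2 b F\<^bsub>n-1\<^esub>)\<close>; the second summand is what vanishes in
  characteristic two.\<close>

lemma gen_fib_double_char_2: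
  fixes a b :: "'a::comm_ring_1"
  assumes "(2::'a) = 0"
  shows "gen_fib a b (2 * Suc m) = a * (gen_fib a b (Suc m))\<^sup>2"
proof -
  have "gen_fib a b (2 * Suc m) = gen_fib a b (Suc m + m + 1)"
    by (simp only: mult_2 add_Suc add_Suc_right add_0_right One_nat_def)
  also have "\<dots> = gen_fib a b (Suc (Suc m)) * gen_fib a b (Suc m)
      + b * gen_fib a b (Suc m) * gen_fib a b m"
    using gen_fib_add[of a b "Suc m" m] by (simp only: Suc_eq_plus1)
  also have "\<dots> = a * (gen_fib a b (Suc m))\<^sup>2
      + 2 * (b * gen_fib a b (Suc m) * gen_fib a b m)"
    by (simp add: power2_eq_square algebra_simps)
  finally have "gen_fib a b (2 * Suc m) = a * (gen_fib a b (Suc m))\<^sup>2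
      + 2 * (b * gen_fib a b (Suc m) * gen_fib a b m)" .
  then show ?thesis using assms by simp
qed

lemma gen_fib_double_plus_1:
  fixes a b :: "'a::comm_ring_1"
  shows "gen_fib a b (2 * m + 1) = (gen_fib a b (Suc m))\<^sup>2 + b * (gen_fib a b m)\<^sup>2"
  using gen_fib_add[of a b m m] by (simp add: power2_eq_square ac_simps flip: mult_2)

lemma gen_fib_pow2_char_2:
  fixes a b :: "'a::comm_ring_1"
  assumes "(2::'a) = 0"
  shows "gen_fib a b (2 ^ i) = a ^ (2 ^ i - 1)"
proof (induction i)
  case (Suc i)
  obtain m where m: "2 ^ i = Suc m"
    using not0_implies_Suc[of "2 ^ i"] by auto
  have "gen_fib a b (2 ^ Suc i) = a * (a ^ m)\<^sup>2"
    using gen_fib_double_char_2[OF assms, of a b m] Suc by (simp add: m)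
  also have "\<dots> = a ^ (2 ^ Suc i - 1)"
    by (simp add: m power2_eq_square flip: power_add mult_2)
  finally show ?case .
qed simp

text \<open>The partial traces of \<open>c\<close> arise here: passing from \<open>i\<close> to \<open>i + 1\<close> squares the sum, which
  raises every exponent \<open>2 ^ j\<close> to \<open>2 ^ (j + 1)\<close>, and adds the missing first term \<open>c\<close>.  Writing
  \<open>b = c a\<^sup>2\<close> makes this an identity without division.\<close>

lemma gen_fib_pow2_minus_1_char_2:
  fixes a c :: "'a::comm_ring_1"
  assumes "(2::'a) = 0"
  shows "c * a\<^sup>2 * gen_fib a (c * a\<^sup>2) (2 ^ i - 1) = a ^ 2 ^ i * (\<Sum>j<i. c ^ 2 ^ j)"
proof (induction i)
  case (Suc i)
  obtain m where m: "2 ^ i = Suc m"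
    using not0_implies_Suc[of "2 ^ i"] by auto
  define b where "b = c * a\<^sup>2"
  have IH: "b * gen_fib a b m = a ^ Suc m * (\<Sum>j<i. c ^ 2 ^ j)"
    using Suc by (simp add: m b_def)
  have F: "gen_fib a b (Suc m) = a ^ m"
    using gen_fib_pow2_char_2[OF assms, of a b i] by (simp add: m)
  have ix: "2 ^ Suc i - 1 = 2 * m + 1" by (simp add: m)
  have "b * gen_fib a b (2 ^ Suc i - 1) = b * (a ^ m)\<^sup>2 + (b * gen_fib a b m)\<^sup>2"
    unfolding ix gen_fib_double_plus_1 F by (simp add: power2_eq_square algebra_simps)
  also have "b * (a ^ m)\<^sup>2 = (a ^ Suc m)\<^sup>2 * c"
    by (simp add: b_def power2_eq_square algebra_simps)
  also have "(b * gen_fib a b m)\<^sup>2 = (a ^ Suc m)\<^sup>2 * (\<Sum>j<i. (c ^ 2 ^ j)\<^sup>2)"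
    by (simp only: IH power_mult_distrib char_2_square_sum[OF assms])
  also have "(a ^ Suc m)\<^sup>2 * c + (a ^ Suc m)\<^sup>2 * (\<Sum>j<i. (c ^ 2 ^ j)\<^sup>2)
      = (a ^ Suc m)\<^sup>2 * (c + (\<Sum>j<i. c ^ 2 ^ Suc j))"
    by (simp add: distrib_left mult.commute flip: power_mult)
  also have "c + (\<Sum>j<i. c ^ 2 ^ Suc j) = (\<Sum>j<Suc i. c ^ 2 ^ j)"
    by (simp only: sum.lessThan_Suc_shift) simp
  also have "(a ^ Suc m)\<^sup>2 = a ^ 2 ^ Suc i"
    unfolding power_mult[symmetric] m[symmetric] by (simp add: mult.commute)
  finally show ?case by (simp only: b_def)
qed simp


section \<open>Ranks and periods divide all their multiples\<close>

text \<open>Closure under differences is all that Euclid's division by repeated subtraction needs, so it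
  covers the rank and the period alike.\<close>

lemma Least_pos_dvd:
  fixes Q :: "nat \<Rightarrow> bool"
  assumes diff: "\<And>m n. Q m \<Longrightarrow> Q n \<Longrightarrow> m \<le> n \<Longrightarrow> Q (n - m)"
    and "Q n"
  shows "(LEAST n. n > 0 \<and> Q n) dvd n"
  using \<open>Q n\<close>
proof (induction n rule: less_induct)
  case (less n)
  define k where "k = (LEAST n. n > 0 \<and> Q n)"
  show ?case
  proof (cases "n = 0")
    case False
    then have *: "0 < n \<and> Q n" using less.prems by simp
    have k: "0 < k \<and> Q k" unfolding k_def by (rule LeastI[of "\<lambda>n. 0 < n \<and> Q n", OF *])
    have "k \<le> n" unfolding k_def by (rule Least_le[of "\<lambda>n. 0 < n \<and> Q n", OF *])
    then have "k dvd n - k"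
      using k less diff unfolding k_def[symmetric] by auto
    then show ?thesis
      using \<open>k \<le> n\<close> unfolding k_def[symmetric] by (simp add: dvd_minus_self)
  qed simp
qed

text \<open>Once the sequence vanishes modulo \<open>P\<close>, it repeats itself up to the factor given by the next
  term.  The sequence starts again in earnest when that factor is \<open>1\<close>: this is what separates the
  period from the rank.\<close>

lemma gen_fib_shift:
  fixes a b P :: "'a::field poly"
  assumes "[gen_fib a b m = 0] (mod P)"
  shows "[gen_fib a b (m + k) = gen_fib a b (m + 1) * gen_fib a b k] (mod P)"
proof (cases k)
  case 0
  with assms show ?thesis by simp
next
  case (Suc k')
  have "P dvd gen_fib a b m" using assms by (simp add: cong_0_iff)
  then show ?thesis
    using gen_fib_add[of a b m k'] by (simp add: Suc cong_iff_dvd_diff)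
qed

text \<open>If \<open>P\<close> divided two neighbours, the recurrence could be run backwards, as \<open>b\<close> is invertible
  modulo \<open>P\<close>, down to \<open>F\<^sub>1 = 1\<close>.\<close>

lemma gen_fib_consecutive:
  fixes a b P :: "'a::field poly"
  assumes "prime_elem P" "\<not> P dvd b" "P dvd gen_fib a b n"
  shows "\<not> P dvd gen_fib a b (n + 1)"
  using assms
proof (induction n)
  case 0
  then show ?case using prime_elem_not_unit by auto
next
  case (Suc n)
  show ?case
  proof
    assume "P dvd gen_fib a b (Suc n + 1)"
    then have "P dvd b * gen_fib a b n"
      using Suc.prems(3) by (simp add: dvd_add_right_iff)
    then have "P dvd gen_fib a b n"
      using Suc.prems by (auto dest: prime_elem_dvd_multD)
    then show False using Suc by simp
  qed
qed

lemma fib_rank_dvd: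
  fixes a b P :: "'a::field poly"
  assumes "prime_elem P" "\<not> P dvd b" "[gen_fib a b n = 0] (mod P)"
  shows "fib_rank a b P dvd n"
  unfolding fib_rank_def
proof (rule Least_pos_dvd)
  fix m n assume m: "[gen_fib a b m = 0] (mod P)" and n: "[gen_fib a b n = 0] (mod P)"
    and le: "m \<le> n"
  have "[gen_fib a b (m + 1) * gen_fib a b (n - m) = 0] (mod P)"
    using gen_fib_shift[OF m, of "n - m"] n le by (metis cong_sym cong_trans le_add_diff_inverse)
  moreover have "\<not> P dvd gen_fib a b (m + 1)"
    using gen_fib_consecutive[OF assms(1,2)] m by (simp add: cong_0_iff)
  ultimately show "[gen_fib a b (n - m) = 0] (mod P)"
    using assms(1) by (auto simp: cong_0_iff dest: prime_elem_dvd_multD)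
qed (rule assms)

lemma fib_period_dvd:
  fixes a b P :: "'a::field poly"
  assumes "[gen_fib a b n = 0] (mod P)" "[gen_fib a b (n + 1) = 1] (mod P)"
  shows "fib_period a b P dvd n"
  unfolding fib_period_def
proof (rule Least_pos_dvd)
  fix m n
  assume m: "[gen_fib a b m = 0] (mod P) \<and> [gen_fib a b (m + 1) = 1] (mod P)"
    and n: "[gen_fib a b n = 0] (mod P) \<and> [gen_fib a b (n + 1) = 1] (mod P)"
    and le: "m \<le> n"
  have shift: "[gen_fib a b k = gen_fib a b (m + k)] (mod P)" for k
    using gen_fib_shift[of a b m P k] cong_mult[of "gen_fib a b (m + 1)" 1 P "gen_fib a b k"] m
    by (metis cong_refl cong_sym cong_trans mult_1)
  show "[gen_fib a b (n - m) = 0] (mod P) \<and> [gen_fib a b (n - m + 1) = 1] (mod P)"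
    using shift[of "n - m"] shift[of "n - m + 1"] n le by (auto intro: cong_trans)
qed (use assms in simp)

text \<open>Each round of \<open>m\<close> steps contributes one more factor \<open>g\<close>.\<close>

lemma gen_fib_multiples:
  fixes a b g P :: "'a::field poly"
  assumes "[gen_fib a b m = 0] (mod P)" "[gen_fib a b (m + 1) = g] (mod P)"
  shows "[gen_fib a b (m * k) = 0] (mod P) \<and> [gen_fib a b (m * k + 1) = g ^ k] (mod P)"
proof (induction k)
  case (Suc k)
  have step: "[gen_fib a b (m + j) = g * gen_fib a b j] (mod P)" for j
    using cong_trans[OF gen_fib_shift[OF assms(1)] cong_scalar_right[OF assms(2)]] .
  have "[gen_fib a b (m + m * k) = g * 0] (mod P)"
    using cong_trans[OF step cong_scalar_left] Suc by blast
  moreover have "[gen_fib a b (m + (m * k + 1)) = g * g ^ k] (mod P)"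
    using cong_trans[OF step cong_scalar_left] Suc by blast
  ultimately show ?case by (simp add: add.assoc)
qed simp


section \<open>The residue field modulo an irreducible polynomial\<close>

text \<open>The bound is put on the coefficients and not on the degree so that \<open>n = 0\<close> gives exactly the
  zero polynomial; the induction then strips off the constant coefficient.\<close>

lemma card_polys_coeffs_vanish:
  "finite {p::'a::{field,finite} poly. \<forall>i\<ge>n. coeff p i = 0} \<and>
   card {p::'a poly. \<forall>i\<ge>n. coeff p i = 0} = CARD('a) ^ n"
proof (induction n)
  case 0
  have "{p::'a poly. \<forall>i\<ge>0. coeff p i = 0} = {0}" by (auto simp: poly_eq_iff)
  then show ?case by simp
next
  case (Suc n)
  let ?S = "\<lambda>n. {p::'a poly. \<forall>i\<ge>n. coeff p i = 0}"
  let ?f = "\<lambda>(c, p). pCons c p :: 'a poly"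
  have eq: "?S (Suc n) = ?f ` (UNIV \<times> ?S n)"
  proof (intro equalityI subsetI)
    fix p assume p: "p \<in> ?S (Suc n)"
    obtain c r where "p = pCons c r" by (cases p)
    moreover from p this have "r \<in> ?S n" by (auto simp: coeff_pCons_Suc dest: spec[of _ "Suc _"])
    ultimately show "p \<in> ?f ` (UNIV \<times> ?S n)" by force
  qed (auto simp: coeff_pCons split: nat.split)
  have "inj_on ?f (UNIV \<times> ?S n)" by (auto simp: inj_on_def)
  then show ?case unfolding eq using Suc by (simp add: card_image card_cartesian_product)
qed

lemma card_polys_degree_less:
  fixes P :: "'a::{field,finite} poly"
  assumes "degree P > 0"
  shows "finite {r :: 'a poly. degree r < degree P}"
    and "card {r :: 'a poly. degree r < degree P} = CARD('a) ^ degree P"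
proof -
  have "{r :: 'a poly. degree r < degree P} = {p::'a poly. \<forall>i\<ge>degree P. coeff p i = 0}"
    using assms by (auto intro: coeff_eq_0 degree_lessI)
  then show "finite {r :: 'a poly. degree r < degree P}"
    and "card {r :: 'a poly. degree r < degree P} = CARD('a) ^ degree P"
    using card_polys_coeffs_vanish[of "degree P", where ?'a='a] by auto
qed

lemma irreducible_poly_degree_pos:
  fixes P :: "'a::field poly"
  assumes "irreducible P"
  shows "degree P > 0"
  using assms by (metis irreducible_def is_unit_iff_degree neq0_conv)

lemma one_less_card_power_degree:
  fixes P :: "'a::{field,finite} poly"
  assumes "irreducible P"
  shows "CARD('a) ^ degree P > 1"
proof -
  have "card {0, 1 :: 'a} \<le> CARD('a)" by (rule card_mono) auto
  then have "1 < CARD('a)" by simp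
  then show ?thesis using irreducible_poly_degree_pos[OF assms] by (rule one_less_power)
qed

lemma cong_mult_cancel_prime:
  fixes P g x y :: "'a::field poly"
  assumes "prime_elem P" "\<not> P dvd g" "[g * x = g * y] (mod P)"
  shows "[x = y] (mod P)"
  using assms by (auto simp: cong_iff_dvd_diff simp flip: right_diff_distrib
      dest: prime_elem_dvd_multD)

text \<open>Euler's argument: multiplication by \<open>g\<close> permutes the nonzero reduced residues, and comparing
  their product before and after leaves the power of \<open>g\<close>.\<close>

lemma poly_fermat:
  fixes P g :: "'a::{field,finite} poly"
  assumes irr: "irreducible P" and g: "\<not> P dvd g"
  shows "[g ^ (CARD('a) ^ degree P - 1) = 1] (mod P)"
proof -
  have prime: "prime_elem P" using irr by (rule field_poly_irreducible_imp_prime)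
  have deg: "degree P > 0" using irr by (rule irreducible_poly_degree_pos)
  define S where "S = {r :: 'a poly. degree r < degree P} - {0}"
  have fin: "finite S" unfolding S_def using card_polys_degree_less[OF deg] by simp
  have card: "card S = CARD('a) ^ degree P - 1"
    unfolding S_def using card_polys_degree_less[OF deg] deg by simp
  have not_dvd: "\<not> P dvd s" if "s \<in> S" for s
    using that dvd_imp_degree_le[of P s] by (auto simp: S_def)
  define f where "f s = (g * s) mod P" for s
  have f_cong: "[f s = g * s] (mod P)" for s by (simp add: f_def)
  have inj: "inj_on f S"
  proof (rule inj_onI)
    fix s t assume st: "s \<in> S" "t \<in> S" "f s = f t"
    then have "[g * s = g * t] (mod P)" by (simp add: f_def cong_def)
    then have "[s = t] (mod P)" by (rule cong_mult_cancel_prime[OF prime g])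
    then show "s = t" using st by (simp add: cong_def S_def mod_poly_less)
  qed
  have "f ` S \<subseteq> S"
  proof
    fix t assume "t \<in> f ` S"
    then obtain s where s: "s \<in> S" "t = f s" by auto
    have "\<not> P dvd g * s" using not_dvd[OF s(1)] g prime by (auto dest: prime_elem_dvd_multD)
    then have "t \<noteq> 0" using s by (simp add: f_def mod_eq_0_iff_dvd)
    moreover have "degree t < degree P"
      using s degree_mod_less'[of P "g * s"] deg \<open>t \<noteq> 0\<close> by (force simp: f_def)
    ultimately show "t \<in> S" by (simp add: S_def)
  qed
  then have "f ` S = S" using fin inj by (simp add: endo_inj_surj)
  then have "\<Prod>S = (\<Prod>s\<in>S. f s)" using prod.reindex[OF inj, of "\<lambda>x. x"] by simp
  moreover have "[(\<Prod>s\<in>S. f s) = (\<Prod>s\<in>S. g * s)] (mod P)"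
    by (rule cong_prod) (rule f_cong)
  moreover have "(\<Prod>s\<in>S. g * s) = \<Prod>S * g ^ card S" by (simp add: prod.distrib)
  ultimately have "[\<Prod>S * g ^ card S = \<Prod>S * 1] (mod P)" by (simp add: cong_sym_eq)
  moreover have "\<not> P dvd \<Prod>S"
    using fin not_dvd
    by (induction S rule: finite_induct)
      (use prime in \<open>auto simp: prime_elem_dvd_mult_iff prime_elem_not_unit\<close>)
  ultimately show ?thesis unfolding card[symmetric]
    using cong_mult_cancel_prime[OF prime] by blast
qed

text \<open>The description defining the quotient is proper because \<open>h\<close> has an inverse modulo \<open>P\<close>, namely
  \<open>h ^ (q ^ d - 2)\<close> by Fermat's theorem.\<close>

lemma quot_mod_cong:
  fixes P g h :: "'a::{field,finite} poly"
  assumes irr: "irreducible P" and h: "\<not> P dvd h"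
  shows "[quot_mod P g h * h = g] (mod P)"
proof -
  have prime: "prime_elem P" using irr by (rule field_poly_irreducible_imp_prime)
  define N where "N = CARD('a) ^ degree P - 1"
  have "CARD('a) ^ degree P > 1" using irr by (rule one_less_card_power_degree)
  then have N: "N = Suc (N - 1)" by (simp add: N_def)
  have h_inv: "[h ^ (N - 1) * h = 1] (mod P)"
    using poly_fermat[OF irr h] N power_Suc2 unfolding N_def[symmetric] by metis
  define r where "r = (g * h ^ (N - 1)) mod P"
  have "[r * h = g * h ^ (N - 1) * h] (mod P)"
    unfolding r_def by (intro cong_scalar_right) simp
  also have "[g * h ^ (N - 1) * h = g] (mod P)"
    using cong_scalar_left[OF h_inv, of g] by (simp add: mult.assoc)
  finally have r: "r mod P = r \<and> [r * h = g] (mod P)" by (simp add: r_def)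
  have unique: "s = r" if "s mod P = s \<and> [s * h = g] (mod P)" for s
  proof -
    have "[h * s = h * r] (mod P)"
      using that r by (metis cong_sym cong_trans mult.commute)
    then have "[s = r] (mod P)" by (rule cong_mult_cancel_prime[OF prime h])
    then show ?thesis using that r by (simp add: cong_def)
  qed
  have "quot_mod P g h = r" unfolding quot_mod_def by (rule the_equality) (fact r, fact unique)
  with r show ?thesis by simp
qed

lemma poly_ord_power:
  fixes P g :: "'a::{field,finite} poly"
  assumes irr: "irreducible P" and g: "\<not> P dvd g"
  shows "poly_ord P g > 0 \<and> [g ^ poly_ord P g = 1] (mod P)"
  unfolding poly_ord_def
proof (rule LeastI)
  have "CARD('a) ^ degree P > 1" using irr by (rule one_less_card_power_degree)
  then show "CARD('a) ^ degree P - 1 > 0 \<and> [g ^ (CARD('a) ^ degree P - 1) = 1] (mod P)"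
    using poly_fermat[OF assms] by simp
qed

text \<open>Translation by \<open>1\<close> permutes the field, so the sum of all elements stays the same when the
  number of elements is added to it.\<close>

lemma two_eq_0_if_card_pow2:
  assumes "CARD('a::{field,finite}) = 2 ^ l"
  shows "(2 :: 'a) = 0"
proof -
  have "(\<Sum>x\<in>UNIV. x) = (\<Sum>x\<in>UNIV. x + (1::'a))"
    by (rule sum.reindex_bij_witness[of _ "\<lambda>x. x + 1" "\<lambda>x. x - 1"]) auto
  then have "of_nat CARD('a) = (0::'a)" by (simp add: sum.distrib)
  then show ?thesis by (simp add: assms)
qed


section \<open>The sequence modulo an irreducible polynomial\<close>

text \<open>Squaring shifts the terms of the trace cyclically, since \<open>c ^ 2 ^ n\<close> is \<open>c\<close> again.  So the trace
  is a root of \<open>X\<^sup>2 - X\<close>, and modulo a prime only \<open>0\<close> and \<open>1\<close> are.\<close>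

lemma trace_0_or_1:
  fixes P c :: "'a::field poly"
  assumes two: "(2::'a poly) = 0" and prime: "prime_elem P"
    and c: "[c ^ 2 ^ n = c] (mod P)"
  defines "T \<equiv> \<Sum>i<n. c ^ 2 ^ i"
  shows "[T = 0] (mod P) \<or> [T = 1] (mod P)"
proof -
  have "T\<^sup>2 = (\<Sum>i<n. c ^ 2 ^ Suc i)"
    unfolding T_def char_2_square_sum[OF two] by (simp add: mult.commute flip: power_mult)
  moreover have "c + (\<Sum>i<n. c ^ 2 ^ Suc i) = T + c ^ 2 ^ n"
    unfolding T_def using sum.lessThan_Suc_shift[of "\<lambda>i. c ^ 2 ^ i" n] by simp
  ultimately have "T * (T - 1) = c ^ 2 ^ n - c"
    by (simp add: power2_eq_square algebra_simps)
  then have "P dvd T * (T - 1)" using c by (simp add: cong_iff_dvd_diff)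
  then show ?thesis using prime by (auto simp: cong_iff_dvd_diff dest: prime_elem_dvd_multD)
qed

text \<open>The closed forms at \<open>2 ^ n\<close>, transported from \<open>c a\<^sup>2\<close> to the congruent \<open>b\<close>.\<close>

lemma gen_fib_at_field_size:
  fixes a b c P :: "'a::field poly"
  assumes two: "(2::'a poly) = 0" and b: "[c * a\<^sup>2 = b] (mod P)"
    and a: "[a ^ (2 ^ n - 1) = 1] (mod P)"
  shows "[gen_fib a b (2 ^ n) = 1] (mod P)"
    and "[b * gen_fib a b (2 ^ n - 1) = a * (\<Sum>i<n. c ^ 2 ^ i)] (mod P)"
proof -
  show "[gen_fib a b (2 ^ n) = 1] (mod P)"
    using a by (simp add: gen_fib_pow2_char_2[OF two])
  have "[b * gen_fib a b (2 ^ n - 1) = c * a\<^sup>2 * gen_fib a (c * a\<^sup>2) (2 ^ n - 1)] (mod P)"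
    using b by (intro cong_mult gen_fib_cong) (simp_all add: cong_sym)
  also have "c * a\<^sup>2 * gen_fib a (c * a\<^sup>2) (2 ^ n - 1) = a * a ^ (2 ^ n - 1) * (\<Sum>i<n. c ^ 2 ^ i)"
    unfolding gen_fib_pow2_minus_1_char_2[OF two] by (simp flip: power_Suc)
  also have "[a * a ^ (2 ^ n - 1) * (\<Sum>i<n. c ^ 2 ^ i) = a * 1 * (\<Sum>i<n. c ^ 2 ^ i)] (mod P)"
    by (intro cong_mult a) simp_all
  finally show "[b * gen_fib a b (2 ^ n - 1) = a * (\<Sum>i<n. c ^ 2 ^ i)] (mod P)" by simp
qed

text \<open>In this case \<open>F\<^bsub>2k\<^esub> \<equiv> 0\<close> and \<open>F\<^bsub>2k+1\<^esub> \<equiv> b ^ k\<close>; the odd terms are never zero, so a period is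
  even, and \<open>2k\<close> is one exactly when \<open>b ^ k \<equiv> 1\<close>.\<close>

lemma fib_rank_period_0:
  fixes a b P :: "'a::{field,finite} poly"
  assumes irr: "irreducible P" and b: "\<not> P dvd b" and a: "[a = 0] (mod P)"
  shows "fib_rank a b P = 2" "fib_period a b P = 2 * poly_ord P b"
proof -
  have prime: "prime_elem P" using irr by (rule field_poly_irreducible_imp_prime)
  have F2: "[gen_fib a b 2 = 0] (mod P)" using a by (simp add: numeral_2_eq_2)
  have "[gen_fib a b (2 + 1) = b] (mod P)"
    using a by (simp add: numeral_2_eq_2 cong_iff_dvd_diff)
  note even = gen_fib_multiples[OF F2 this]
  have odd: "\<not> [gen_fib a b (2 * k + 1) = 0] (mod P)" for k
    using gen_fib_consecutive[OF prime b] even[of k] by (simp add: cong_0_iff)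
  show "fib_rank a b P = 2"
    unfolding fib_rank_def
  proof (rule Least_equality)
    fix n assume "0 < n \<and> [gen_fib a b n = 0] (mod P)"
    with odd[of 0] show "2 \<le> n" by (cases "n = 1") auto
  qed (use F2 in simp)
  have ord: "poly_ord P b > 0" "[b ^ poly_ord P b = 1] (mod P)"
    using poly_ord_power[OF irr b] by auto
  show "fib_period a b P = 2 * poly_ord P b"
    unfolding fib_period_def
  proof (rule Least_equality)
    show "0 < 2 * poly_ord P b \<and> [gen_fib a b (2 * poly_ord P b) = 0] (mod P) \<and>
          [gen_fib a b (2 * poly_ord P b + 1) = 1] (mod P)"
      using ord even[of "poly_ord P b"] cong_trans by auto
    fix n assume n: "0 < n \<and> [gen_fib a b n = 0] (mod P) \<and> [gen_fib a b (n + 1) = 1] (mod P)"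
    then obtain k where k: "n = 2 * k"
      using odd by (metis oddE evenE)
    have "[b ^ k = 1] (mod P)" using n even[of k] by (auto simp: k intro: cong_trans cong_sym)
    then have "poly_ord P b \<le> k"
      unfolding poly_ord_def using n k by (intro Least_le) simp
    then show "2 * poly_ord P b \<le> n" by (simp add: k)
  qed
qed

theorem theorem5p2:
  fixes a b P :: "'a::{field,finite} poly" and q l d :: nat
  assumes "q = CARD('a)" and "q = 2 ^ l" and "l \<ge> 1"
    and "b \<noteq> 0"
    and "irreducible P" and "coprime b P"
    and "d = degree P"
  shows "(\<not> [a = 0] (mod P) \<and> [trace_mod l P (quot_mod P b (a ^ 2)) = 0] (mod P) \<longrightarrow>
            fib_rank a b P dvd q ^ d - 1 \<and> fib_period a b P dvd q ^ d - 1) \<and>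
         (\<not> [a = 0] (mod P) \<and> \<not> [trace_mod l P (quot_mod P b (a ^ 2)) = 0] (mod P) \<longrightarrow>
            fib_rank a b P dvd q ^ d + 1 \<and> fib_period a b P dvd (q ^ d + 1) * poly_ord P b) \<and>
         ([a = 0] (mod P) \<longrightarrow>
            fib_rank a b P = 2 \<and> fib_period a b P = 2 * poly_ord P b)"
proof -
  have b: "\<not> P dvd b"
  proof
    assume "P dvd b"
    then have "is_unit P" using assms(6) coprime_common_divisor[of b P P] by simp
    then show False using assms(5) by (simp add: irreducible_def)
  qed
  show ?thesis
  proof (cases "[a = 0] (mod P)")
    case True
    then show ?thesis using fib_rank_period_0[OF assms(5) b True] by simp
  next
    case False
    have prime: "prime_elem P" using assms(5) by (rule field_poly_irreducible_imp_prime)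
    have a: "\<not> P dvd a" using False by (simp add: cong_0_iff)
    then have a2: "\<not> P dvd a\<^sup>2" using prime by (auto dest: prime_elem_dvd_power)
    have "(2::'a) = 0" using two_eq_0_if_card_pow2 assms(1,2) by metis
    then have two: "(2::'a poly) = 0" by (simp add: numeral_poly)
    define n where "n = d * l"
    define c where "c = quot_mod P b (a\<^sup>2)"
    define T where "T = (\<Sum>i<n. c ^ 2 ^ i)"
    have N: "q ^ d = 2 ^ n"
      by (simp add: assms(2) n_def mult.commute flip: power_mult)
    have fermat: "[g ^ (2 ^ n - 1) = 1] (mod P)" if "\<not> P dvd g" for g
      using poly_fermat[OF assms(5) that] N assms(1,7) by simp
    have c: "[c * a\<^sup>2 = b] (mod P)" unfolding c_def by (rule quot_mod_cong[OF assms(5) a2])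
    have "\<not> P dvd c"
      using c b by (metis cong_dvd_iff dvd_mult2)
    then have "[c * c ^ (2 ^ n - 1) = c * 1] (mod P)" by (intro cong_scalar_left fermat)
    then have "[c ^ 2 ^ n = c] (mod P)" by (simp flip: power_Suc)
    note T01 = trace_0_or_1[OF two prime this, folded T_def]
    have tr: "[trace_mod l P (quot_mod P b (a\<^sup>2)) = 0] (mod P) \<longleftrightarrow> [T = 0] (mod P)"
      by (simp add: trace_mod_def T_def c_def n_def assms(7))
    note F = gen_fib_at_field_size[OF two c fermat[OF a], folded T_def]
    show ?thesis
    proof (cases "[T = 0] (mod P)")
      case True
      have "[b * gen_fib a b (2 ^ n - 1) = 0] (mod P)"
        using cong_trans[OF F(2) cong_scalar_left[OF True, of a]] by simp
      then have "[gen_fib a b (2 ^ n - 1) = 0] (mod P)"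
        using prime b by (auto simp: cong_0_iff dest: prime_elem_dvd_multD)
      then have "fib_rank a b P dvd 2 ^ n - 1" "fib_period a b P dvd 2 ^ n - 1"
        using F(1) by (simp_all add: fib_rank_dvd[OF prime b] fib_period_dvd)
      then show ?thesis using True False by (simp add: tr N)
    next
      case T: False
      with T01 have T1: "[T = 1] (mod P)" by simp
      have bF: "[b * gen_fib a b (2 ^ n - 1) = a] (mod P)"
        using cong_trans[OF F(2) cong_scalar_left[OF T1, of a]] by simp
      obtain m where m: "2 ^ n = Suc m" using not0_implies_Suc[of "2 ^ n"] by auto
      have "gen_fib a b (2 ^ n + 1) = a * gen_fib a b (2 ^ n) + b * gen_fib a b (2 ^ n - 1)"
        by (simp add: m)
      also have "[a * gen_fib a b (2 ^ n) + b * gen_fib a b (2 ^ n - 1) = a * 1 + a] (mod P)"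
        by (intro cong_add cong_scalar_left F(1) bF)
      also have "a * 1 + a = 0" using two by (metis mult_2 mult_1_right mult_zero_left)
      finally have zero: "[gen_fib a b (2 ^ n + 1) = 0] (mod P)" .
      have "gen_fib a b (2 ^ n + 1 + 1) = a * gen_fib a b (2 ^ n + 1) + b * gen_fib a b (2 ^ n)"
        by simp
      also have "[a * gen_fib a b (2 ^ n + 1) + b * gen_fib a b (2 ^ n) = a * 0 + b * 1] (mod P)"
        by (intro cong_add cong_scalar_left F(1) zero)
      finally have "[gen_fib a b (2 ^ n + 1 + 1) = a * 0 + b * 1] (mod P)" .
      then have "[gen_fib a b (2 ^ n + 1 + 1) = b] (mod P)" by simp
      note mult = gen_fib_multiples[OF zero this, of "poly_ord P b"]
      have "fib_rank a b P dvd 2 ^ n + 1" by (rule fib_rank_dvd[OF prime b zero])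
      moreover have "fib_period a b P dvd (2 ^ n + 1) * poly_ord P b"
        using mult poly_ord_power[OF assms(5) b] by (intro fib_period_dvd) (auto intro: cong_trans)
      ultimately show ?thesis using T False by (simp add: tr N)
    qed
  qed
qed

end
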